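(* For all integers $d\ge 1$, $K_{d,1}^+=K_d^+$. Here $K_d^+$ is the least constant $K$ such that $\mathbb{S}_d^+\subseteq K\,\mathrm{Conv}(\mathbb{D}_d^+)$, and $K_{d,1}^+$ is the least constant $K$ such that $\mathrm{S}_d\subseteq K\,\mathrm{Conv}(\mathbb{D}_d^+)$.
   Context: Fix an orthonormal basis of a $d$-dimensional complex Hilbert space $\mathcal{H}_d$ and let $\mathrm{L}(\mathcal{H}_d)$ be the space of linear operators on it, identified with $d\times d$ complex matrices. For a matrix $S=[s_{kj}]$, the Schur multiplier $\Phi_S:\mathrm{L}(\mathcal{H}_d)\to\mathrm{L}(\mathcal{H}_d)$ is $\Phi_S(X)=S\circ X=[s_{kj}x_{kj}]$. With $\|X\|_1=\mathrm{Tr}|X|$ and $\|\Phi\|_1=\sup_{\|X\|_1\le1}\|\Phi(X)\|_1$, let $\mathbb{S}_d=\{\Phi_S:\|\Phi_S\|_1\le 1\}$, and let $\mathbb{S}_d^+$ be the set of $\Phi_S\in\mathbb{S}_d$ that are positive (i.e. map positive semidefinite operators to positive semidefinite operators, equivalently $S\ge0$); equivalently, $\Phi_S\in\mathbb{S}_d^+$ iff there are a Hilbert space $\mathcal{K}$ and vectors $\xi_1,\dots,\xi_d$ in its closed unit ball with $s_{kj}=\langle\xi_k|\xi_j\rangle$. $\mathbb{D}_d^+$ is the set of Schur multipliers $\Phi_S$ with $s_{kj}=\alpha_k^*\alpha_j$ for some complex numbers $\alpha_1,\dots,\alpha_d$ with $\max_k|\alpha_k|\le1$. $\mathrm{S}_d$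 is the set of Schur channels, i.e. $\Phi_S$ with $S$ positive semidefinite and $s_{kk}=1$ for all $k$. $\mathrm{Conv}$ denotes convex hull and $K\,\mathcal{A}=\{K a:a\in\mathcal{A}\}$. *)

theory Defs
  imports "HOL-Analysis.Analysis"
begin

text \<open>
  Throughout, \<open>d = CARD('n)\<close> for an arbitrary finite index type \<open>'n\<close>, and operators on the
  \<open>d\<close>-dimensional Hilbert space are the matrices of type \<open>complex^'n^'n\<close>.
\<close>

type_synonym 'n cmat = "complex^'n^'n"

text \<open>
  Maps between operators are elements of the real vector space of bounded real-linear maps,
  which contains all complex-linear ones; only its real structure is used, for convex hulls and
  scaling by real constants.
\<close>

type_synonym 'n superop = "('n cmat) \<Rightarrow>\<^sub>L ('n cmat)"

definition conj_transpose :: "'n::finite cmat \<Rightarrow> 'n cmat" where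
  "conj_transpose A = (\<chi> k j. cnj (A $ j $ k))"

text \<open>
  Over the complex numbers, a quadratic form with values in the nonnegative reals forces the
  matrix to be Hermitian.
\<close>

definition psd :: "'n::finite cmat \<Rightarrow> bool" where
  "psd A \<longleftrightarrow> (\<forall>v::complex^'n. (\<Sum>k\<in>UNIV. cnj (v $ k) * (A *v v) $ k) \<in> \<real>\<^sub>\<ge>\<^sub>0)"

definition mat_abs :: "'n::finite cmat \<Rightarrow> 'n cmat" where
  "mat_abs X = (THE P. psd P \<and> P ** P = conj_transpose X ** X)"

definition trace_norm :: "'n::finite cmat \<Rightarrow> real" where
  "trace_norm X = Re (trace (mat_abs X))"

text \<open>The supremum is taken in \<open>ereal\<close>, so that it needs no boundedness side condition.\<close>

definition superop_norm1 :: "'n::finite superop \<Rightarrow> ereal" where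
  "superop_norm1 \<Phi> = (SUP X\<in>{X. trace_norm X \<le> 1}. ereal (trace_norm (blinfun_apply \<Phi> X)))"

definition positive_superop :: "'n::finite superop \<Rightarrow> bool" where
  "positive_superop \<Phi> \<longleftrightarrow> (\<forall>X. psd X \<longrightarrow> psd (blinfun_apply \<Phi> X))"

definition schur_multiplier :: "'n::finite cmat \<Rightarrow> 'n superop" where
  "schur_multiplier S = Blinfun (\<lambda>X. \<chi> k j. S $ k $ j * X $ k $ j)"

lemma schur_multiplier_apply:
  fixes S X :: "'n::finite cmat"
  shows "blinfun_apply (schur_multiplier S) X = (\<chi> k j. S $ k $ j * X $ k $ j)"
proof -
  have "linear (\<lambda>X::'n cmat. \<chi> k j. S $ k $ j * X $ k $ j)"
    by (rule linearI) (simp_all add: vec_eq_iff algebra_simps)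
  then have "bounded_linear (\<lambda>X::'n cmat. \<chi> k j. S $ k $ j * X $ k $ j)"
    by (simp add: linear_conv_bounded_linear)
  then show ?thesis
    by (simp add: schur_multiplier_def bounded_linear_Blinfun_apply)
qed

definition schur_contractions :: "'n::finite superop set" where
  "schur_contractions = {schur_multiplier S |S. superop_norm1 (schur_multiplier S) \<le> 1}"

definition pos_schur_contractions :: "'n::finite superop set" where
  "pos_schur_contractions = {\<Phi> \<in> schur_contractions. positive_superop \<Phi>}"

definition pos_diag_contractions :: "'n::finite superop set" where
  "pos_diag_contractions =
     {schur_multiplier (\<chi> k j. cnj (\<alpha> $ k) * \<alpha> $ j) |\<alpha>::complex^'n. \<forall>k. cmod (\<alpha> $ k) \<le> 1}"

definition schur_channels :: "'n::finite superop set" where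
  "schur_channels = {schur_multiplier S |S. psd S \<and> (\<forall>k. S $ k $ k = 1)}"

text \<open>
  The two constants are indexed by \<open>d\<close> through the type argument.  The minima exist: the convex
  hull below is compact and contains 0, and it absorbs every Schur multiplier given by a positive
  semidefinite matrix.
\<close>

definition K_plus :: "'n::finite itself \<Rightarrow> real" where
  "K_plus _ = (LEAST K. (pos_schur_contractions :: 'n superop set)
                 \<subseteq> (\<lambda>\<Phi>. K *\<^sub>R \<Phi>) ` (convex hull pos_diag_contractions))"

definition K_plus_1 :: "'n::finite itself \<Rightarrow> real" where
  "K_plus_1 _ = (LEAST K. (schur_channels :: 'n superop set)
                 \<subseteq> (\<lambda>\<Phi>. K *\<^sub>R \<Phi>) ` (convex hull pos_diag_contractions))"

end

theory Submission
  imports Defs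
begin

text \<open>
  For every real \<open>K\<close> the two inclusions whose least constants are compared are equivalent.

  If \<open>S\<close> is positive semidefinite with diagonal at most 1, then \<open>S = D T D\<close>, where \<open>D\<close> is
  the diagonal matrix with entries \<open>\<surd>s\<^sub>k\<^sub>k\<close> and \<open>T\<close> is positive semidefinite with unit
  diagonal.  Composition with the Schur multiplier with entries \<open>d\<^sub>k d\<^sub>j\<close> is linear and preserves
  the multipliers with entries \<open>cnj \<alpha>\<^sub>k \<alpha>\<^sub>j\<close>, \<open>\<bar>\<alpha>\<^sub>k\<bar> \<le> 1\<close>, hence also their convex
  hull, so a bound for \<open>T\<close> gives the same bound for \<open>S\<close>.

  Conversely, a Schur channel is a contraction in the trace norm: by duality with the operator norm,
  it is enough that \<open>S \<circ> W\<close> is an operator-norm contraction whenever \<open>W\<close> is, and this follows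
  from the Gram factorisation of \<open>S\<close> and the Cauchy--Schwarz inequality.
\<close>

section \<open>The spectral theorem\<close>

definition cinner :: "complex^'n::finite \<Rightarrow> complex^'n \<Rightarrow> complex" where
  "cinner u v = (\<Sum>k\<in>UNIV. cnj (u $ k) * v $ k)"

lemma psd_iff_cinner: "psd A \<longleftrightarrow> (\<forall>v. cinner v (A *v v) \<in> \<real>\<^sub>\<ge>\<^sub>0)"
  by (simp add: psd_def cinner_def)

lemma cinner_simps:
  "cinner (u + u') v = cinner u v + cinner u' v"
  "cinner u (v + v') = cinner u v + cinner u v'"
  "cinner u (v - v') = cinner u v - cinner u v'"
  "cinner u (c *s v) = c * cinner u v"
  "cinner (c *s u) v = cnj c * cinner u v"
  "cinner 0 v = 0" "cinner u 0 = 0"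
  by (simp_all add: cinner_def algebra_simps sum.distrib sum_subtractf sum_distrib_left)

lemma cinner_scaleR:
  "cinner u (r *\<^sub>R v) = of_real r * cinner u v"
  "cinner (r *\<^sub>R u) v = of_real r * cinner u v"
  by (simp_all add: cinner_def scaleR_conv_of_real[where 'a = complex] sum_distrib_left algebra_simps)

lemma matrix_vector_scaleR:
  fixes A :: "'n::finite cmat"
  shows "A *v (r *\<^sub>R v) = r *\<^sub>R (A *v v)"
  by (simp add: vec_eq_iff matrix_vector_mult_def scaleR_sum_right)

lemma cnj_cinner: "cnj (cinner u v) = cinner v u"
  by (simp add: cinner_def mult.commute)

lemma norm_sq_vec: "(norm (v :: complex^'n::finite))\<^sup>2 = (\<Sum>k\<in>UNIV. (cmod (v $ k))\<^sup>2)"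
  by (simp add: norm_vec_def L2_set_def sum_nonneg)

lemma cinner_self: "cinner v v = of_real ((norm v)\<^sup>2)"
  by (simp only: cinner_def norm_sq_vec of_real_sum complex_norm_square mult.commute)

lemma cinner_self_eq_0 [simp]: "cinner v v = 0 \<longleftrightarrow> v = 0"
  by (simp add: cinner_self)

lemma cinner_Cauchy_Schwarz: "cmod (cinner u v) \<le> norm u * norm v"
proof -
  have "cmod (cinner u v) \<le> (\<Sum>k\<in>UNIV. \<bar>cmod (u $ k)\<bar> * \<bar>cmod (v $ k)\<bar>)"
    unfolding cinner_def by (rule order_trans[OF norm_sum]) (simp add: norm_mult)
  also have "\<dots> \<le> norm u * norm v"
    unfolding norm_vec_def by (rule L2_set_mult_ineq)
  finally show ?thesis .
qed

lemma cinner_adjoint: "cinner u (A *v w) = cinner (conj_transpose A *v u) w"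
proof -
  have "cinner u (A *v w) = (\<Sum>k\<in>UNIV. \<Sum>j\<in>UNIV. cnj (u $ k) * (A $ k $ j * w $ j))"
    by (simp add: cinner_def matrix_vector_mult_def sum_distrib_left)
  also have "\<dots> = (\<Sum>j\<in>UNIV. \<Sum>k\<in>UNIV. cnj (u $ k) * (A $ k $ j * w $ j))"
    by (rule sum.swap)
  also have "\<dots> = cinner (conj_transpose A *v u) w"
    by (simp add: cinner_def matrix_vector_mult_def conj_transpose_def sum_distrib_left ac_simps)
  finally show ?thesis .
qed

lemma conj_transpose_conj_transpose [simp]: "conj_transpose (conj_transpose A) = A"
  by (simp add: conj_transpose_def vec_eq_iff)

lemma conj_transpose_mult:
  "conj_transpose (A ** B) = conj_transpose B ** conj_transpose A"
  by (simp add: conj_transpose_def vec_eq_iff matrix_matrix_mult_def mult.commute)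

lemma norm_sq_matrix_vector:
  "of_real ((norm (A *v x))\<^sup>2) = cinner x ((conj_transpose A ** A) *v x)"
  by (simp only: cinner_self[symmetric] cinner_adjoint[of x] matrix_vector_mul_assoc[symmetric]
      conj_transpose_mult conj_transpose_conj_transpose)

lemma matrix_entry_cinner: "A $ j $ k = cinner (axis j 1) (A *v axis k 1)"
  by (simp add: cinner_def axis_def matrix_vector_mult_def if_distrib if_distribR
      cong: if_cong)

text \<open>Polarisation: the basis vectors kill the diagonal, and testing on
  \<open>axis j 1 + c *s axis k 1\<close> with c = 1 and c = \<i> gives two independent equations
  for the entries at (j, k) and (k, j).\<close>

lemma cinner_matrix_eq_0_imp:
  fixes B :: "'n::finite cmat"
  assumes "\<And>v. cinner v (B *v v) = 0"
  shows "B = 0"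
proof -
  have "B $ j $ k = 0" for j k
  proof -
    have diag: "B $ i $ i = 0" for i
      using assms[of "axis i 1"] by (simp add: matrix_entry_cinner)
    have E: "c * B $ j $ k + cnj c * B $ k $ j = 0" for c
      using assms[of "axis j 1 + c *s axis k 1"] diag[of j] diag[of k]
      by (simp add: cinner_simps matrix_vector_right_distrib vector_scalar_commute
          matrix_entry_cinner algebra_simps)
    show ?thesis
      using E[of 1] E[of \<i>] by (simp add: complex_eq_iff)
  qed
  then show ?thesis by (simp add: vec_eq_iff)
qed

text \<open>A real-valued quadratic form equals its own conjugate, which is the form of the adjoint.
  So the form of \<open>A - conj_transpose A\<close> vanishes identically.\<close>

lemma psd_imp_hermitian:
  assumes "psd A"
  shows "conj_transpose A = A"
proof -
  have "cinner v ((A - conj_transpose A) *v v) = 0" for v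
  proof -
    have "cinner v (A *v v) \<in> \<real>"
      using assms nonneg_Reals_subset_Reals by (auto simp: psd_iff_cinner)
    then have "cinner v (A *v v) = cnj (cinner v (A *v v))"
      by (simp add: Reals_cnj_iff)
    also have "\<dots> = cinner v (conj_transpose A *v v)"
      by (simp add: cnj_cinner cinner_adjoint)
    finally show ?thesis
      by (simp add: matrix_vector_mult_diff_rdistrib cinner_simps)
  qed
  then show ?thesis
    using cinner_matrix_eq_0_imp by fastforce
qed

text \<open>Orthogonality to fewer than d vectors is a homogeneous system with too few equations.
  Padding it with zero rows to a square matrix gives determinant 0, hence a nontrivial
  kernel.\<close>

lemma ex_nonzero_orthogonal:
  fixes e :: "'n::finite \<Rightarrow> complex^'n"
  assumes "I \<noteq> UNIV"
  shows "\<exists>v. v \<noteq> 0 \<and> (\<forall>i\<in>I. cinner (e i) v = 0)"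
proof -
  define B :: "'n cmat" where "B = (\<chi> i k. if i \<in> I then cnj (e i $ k) else 0)"
  obtain i0 where "i0 \<notin> I" using assms by auto
  then have "row i0 B = 0" by (simp add: row_def B_def vec_eq_iff)
  then have "det B = 0" by (rule det_zero_row(2))
  then have "\<not> (\<exists>B'. B' ** B = mat 1)"
    using invertible_det_nz invertible_left_inverse by blast
  then obtain v where v: "B *v v = 0" "v \<noteq> 0"
    using matrix_left_invertible_ker by blast
  have "cinner (e i) v = 0" if "i \<in> I" for i
    using arg_cong[OF v(1), of "\<lambda>x. x $ i"] that
    by (simp add: B_def matrix_vector_mult_def cinner_def)
  with v(2) show ?thesis by blast
qed

lemma continuous_on_cinner [continuous_intros]:
  assumes "continuous_on T f" "continuous_on T g"
  shows "continuous_on T (\<lambda>x. cinner (f x) (g x))"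
  unfolding cinner_def by (intro continuous_intros assms)

lemma continuous_on_matrix_vector [continuous_intros]:
  fixes A :: "'n::finite cmat"
  assumes "continuous_on T f"
  shows "continuous_on T (\<lambda>x. A *v f x)"
  unfolding matrix_vector_mult_def
  by (intro continuous_intros continuous_on_vec_lambda assms)

text \<open>A maximiser of the Rayleigh quotient is an eigenvector.\<close>

text \<open>The eigenvector is a maximiser of the Rayleigh quotient on the unit sphere of the complement.\<close>

lemma hermitian_ex_eigenvector_orthogonal:
  fixes A :: "'n::finite cmat" and I :: "'n set"
  assumes herm: "conj_transpose A = A" and "I \<noteq> UNIV"
    and eig: "\<And>i. i \<in> I \<Longrightarrow> A *v e i = \<mu> i *\<^sub>R e i"
  shows "\<exists>v m. cinner v v = 1 \<and> (\<forall>i\<in>I. cinner (e i) v = 0) \<and> A *v v = m *\<^sub>R v"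
proof -
  define V where "V = {v. \<forall>i\<in>I. cinner (e i) v = 0}"
  define f where "f v = Re (cinner v (A *v v))" for v
  \<comment> \<open>The complement of eigenvectors is invariant: moving \<open>A\<close> to the left
    slot only multiplies \<open>cinner (e i) v\<close> by \<open>\<mu> i\<close>.\<close>
  have VA: "A *v v \<in> V" if "v \<in> V" for v
    using that by (simp add: V_def cinner_adjoint herm eig cinner_scaleR)
  have Vlin: "u + r *\<^sub>R v \<in> V" if "u \<in> V" "v \<in> V" for u v r
    using that by (simp add: V_def cinner_simps cinner_scaleR)
  have clV: "closed V"
  proof -
    have "V = (\<Inter>i\<in>I. {v. cinner (e i) v = 0})" by (auto simp: V_def)
    moreover have "closed {v. cinner (e i) v = 0}" for i
      by (intro closed_Collect_eq continuous_intros)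
    ultimately show ?thesis by auto
  qed
  have "compact (sphere 0 1 \<inter> V)"
    by (intro compact_Int_closed clV) simp
  moreover have "sphere 0 1 \<inter> V \<noteq> {}"
  proof -
    obtain v where "v \<noteq> 0" "v \<in> V"
      using ex_nonzero_orthogonal[OF \<open>I \<noteq> UNIV\<close>, of e] by (auto simp: V_def)
    then have "(1 / norm v) *\<^sub>R v \<in> sphere 0 1 \<inter> V"
      by (simp add: V_def cinner_scaleR)
    then show ?thesis by blast
  qed
  moreover have "continuous_on (sphere 0 1 \<inter> V) f"
    unfolding f_def by (intro continuous_intros)
  ultimately obtain v where v: "norm v = 1" "v \<in> V"
    and max: "\<And>u. norm u = 1 \<Longrightarrow> u \<in> V \<Longrightarrow> f u \<le> f v"
    by (metis (no_types, lifting) IntD1 IntD2 IntI continuous_attains_sup dist_0_norm mem_sphere)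
  define m where "m = f v"
  have f_scale: "f (r *\<^sub>R u) = r\<^sup>2 * f u" for r u
    by (simp add: f_def cinner_scaleR matrix_vector_scaleR power2_eq_square)
  have bound: "f u \<le> m * (norm u)\<^sup>2" if "u \<in> V" for u
  proof (cases "u = 0")
    case False
    have "f ((1 / norm u) *\<^sub>R u) \<le> m"
      unfolding m_def using that False by (intro max) (auto simp: V_def cinner_scaleR)
    then show ?thesis
      using False by (simp add: f_scale field_simps)
  qed (simp add: f_def cinner_simps)
  define w where "w = A *v v - m *\<^sub>R v"
  have wV: "w \<in> V" using Vlin[OF VA[OF v(2)] v(2), of "- m"] by (simp add: w_def)
  define c where "c = m * (norm w)\<^sup>2 - f w"
  \<comment> \<open>The function m |u|^2 - f(u) is nonnegative on \<open>V\<close> and vanishes at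
    \<open>v\<close>. Its expansion along v + t w is - 2 t |w|^2 + t^2 c, whose linear term must
    vanish.\<close>
  have quad: "2 * t * (norm w)\<^sup>2 \<le> t\<^sup>2 * c" for t
  proof -
    have sq: "(norm x)\<^sup>2 = Re (cinner x x)" for x :: "complex^'n" by (simp add: cinner_self)
    have sym: "Re (cinner x y) = Re (cinner y x)" for x y :: "complex^'n"
      by (simp flip: cnj_cinner[of x y])
    have "Re (cinner v (A *v w)) = Re (cinner w (A *v v))"
      by (simp only: cinner_adjoint[of v] herm sym[of "A *v v"])
    then have "m * (norm (v + t *\<^sub>R w))\<^sup>2 - f (v + t *\<^sub>R w)
        = (m * (norm v)\<^sup>2 - f v) - 2 * t * Re (cinner w (A *v v - m *\<^sub>R v)) + t\<^sup>2 * c"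
      unfolding sq f_def c_def
      by (simp add: matrix_vector_right_distrib matrix_vector_scaleR
          cinner_simps cinner_scaleR sym[of v w] algebra_simps power2_eq_square)
    also have "m * (norm v)\<^sup>2 - f v = 0" by (simp add: v m_def)
    also have "Re (cinner w (A *v v - m *\<^sub>R v)) = (norm w)\<^sup>2" by (simp add: sq w_def)
    finally show ?thesis using bound[OF Vlin[OF v(2) wV, of t]] by simp
  qed
  have "w = 0"
  proof (rule ccontr)
    assume "w \<noteq> 0"
    then have pos: "(norm w)\<^sup>2 > 0" by simp
    \<comment> \<open>Small enough that t c is at most |w|^2, against the lower bound 2 |w|^2; the
      added 1 keeps the denominator positive when c = 0.\<close>
    define t where "t = (norm w)\<^sup>2 / (\<bar>c\<bar> + 1)"
    have "t > 0" using pos by (simp add: t_def add_nonneg_pos)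
    then have "2 * (norm w)\<^sup>2 \<le> t * c"
      using quad[of t] by (simp add: power2_eq_square mult.assoc)
    also have "\<dots> \<le> t * (\<bar>c\<bar> + 1)" using \<open>t > 0\<close> by (intro mult_left_mono) auto
    also have "\<dots> = (norm w)\<^sup>2" by (simp add: t_def add_nonneg_eq_0_iff)
    finally show False using pos by simp
  qed
  then show ?thesis
    using v by (intro exI[of _ v] exI[of _ m]) (auto simp: V_def w_def cinner_self)
qed

definition diag_mat :: "('n::finite \<Rightarrow> real) \<Rightarrow> 'n cmat" where
  "diag_mat l = (\<chi> i j. if i = j then of_real (l i) else 0)"

lemma hermitian_spectral:
  fixes A :: "'n::finite cmat"
  assumes herm: "conj_transpose A = A"
  obtains U l where "conj_transpose U ** U = mat 1" "U ** conj_transpose U = mat 1"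
    "A = U ** diag_mat l ** conj_transpose U"
proof -
  \<comment> \<open>The induction runs over subsets of the index type itself, so that the
    eigenvectors end up indexed by \<open>'n\<close> and can serve as the columns of
    \<open>U\<close>.\<close>
  have "\<exists>e \<mu>. \<forall>i\<in>I. A *v e i = \<mu> i *\<^sub>R e i \<and>
      (\<forall>j\<in>I. cinner (e i) (e j) = (if i = j then 1 else 0))" if "finite I" for I :: "'n set"
    using that
  proof (induction I)
    case (insert k I)
    then obtain e \<mu> where e: "\<And>i. i \<in> I \<Longrightarrow> A *v e i = \<mu> i *\<^sub>R e i"
      "\<And>i j. i \<in> I \<Longrightarrow> j \<in> I \<Longrightarrow> cinner (e i) (e j) = (if i = j then 1 else 0)" by metis
    have "I \<noteq> UNIV" using insert.hyps by auto
    from hermitian_ex_eigenvector_orthogonal[OF herm this, of e \<mu>] e(1)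
    obtain v m where v: "cinner v v = 1" "\<And>i. i \<in> I \<Longrightarrow> cinner (e i) v = 0" "A *v v = m *\<^sub>R v"
      by blast
    moreover have "cinner v (e i) = 0" if "i \<in> I" for i
      using v(2)[OF that] by (metis cnj_cinner complex_cnj_zero)
    ultimately show ?case
      using e insert.hyps
      by (intro exI[of _ "e(k := v)"] exI[of _ "\<mu>(k := m)"]) auto
  qed simp
  from this[OF finite, of UNIV] have "\<exists>e \<mu>. \<forall>i::'n. A *v e i = \<mu> i *\<^sub>R e i \<and>
      (\<forall>j. cinner (e i) (e j) = (if i = j then 1 else 0))"
    by (simp only: ball_UNIV)
  then obtain e \<mu> where "\<forall>i::'n. A *v e i = \<mu> i *\<^sub>R e i \<and>
      (\<forall>j. cinner (e i) (e j) = (if i = j then 1 else 0))"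
    by blast
  then have e: "\<And>i. A *v e i = \<mu> i *\<^sub>R e i"
    "\<And>i j. cinner (e i) (e j) = (if i = j then 1 else 0)"
    by simp_all
  define U :: "'n cmat" where "U = (\<chi> k i. e i $ k)"
  have U: "conj_transpose U ** U = mat 1"
    by (simp add: vec_eq_iff U_def conj_transpose_def matrix_matrix_mult_def mat_def
        e(2)[unfolded cinner_def])
  then have U': "U ** conj_transpose U = mat 1"
    using matrix_left_right_inverse by blast
  have "A ** U = U ** diag_mat \<mu>"
  proof -
    have "(A ** U) $ k $ i = (U ** diag_mat \<mu>) $ k $ i" for k i
      using arg_cong[OF e(1)[of i], of "\<lambda>x. x $ k"]
      by (simp add: U_def diag_mat_def matrix_matrix_mult_def matrix_vector_mult_def
          if_distrib scaleR_conv_of_real[where 'a = complex] mult.commute cong: if_cong)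
    then show ?thesis by (simp add: vec_eq_iff)
  qed
  then have "A = U ** diag_mat \<mu> ** conj_transpose U"
    by (metis U' matrix_mul_assoc matrix_mul_rid)
  with U U' show ?thesis by (rule that)
qed

lemma diag_mat_mult: "diag_mat l ** diag_mat m = diag_mat (\<lambda>i. l i * m i)"
  by (simp add: diag_mat_def matrix_matrix_mult_def vec_eq_iff mult_delta_left)

lemma diag_mat_mult_left: "diag_mat l ** (diag_mat m ** X) = diag_mat (\<lambda>i. l i * m i) ** X"
  by (simp add: matrix_mul_assoc diag_mat_mult)

lemma matrix_inverse_cancel_left:
  fixes A B X :: "'n::finite cmat"
  assumes "A ** B = mat 1"
  shows "A ** (B ** X) = X"
  by (simp add: matrix_mul_assoc assms)

lemma conj_transpose_diag_mat [simp]: "conj_transpose (diag_mat l) = diag_mat l"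
  by (simp add: diag_mat_def conj_transpose_def vec_eq_iff)

lemma trace_diag_mat: "trace (diag_mat l) = of_real (\<Sum>i\<in>UNIV. l i)"
  by (simp add: diag_mat_def trace_def)

lemma cinner_diag_mat: "cinner v (diag_mat l *v v) = of_real (\<Sum>i\<in>UNIV. l i * (cmod (v $ i))\<^sup>2)"
proof -
  have "cinner v (diag_mat l *v v) = (\<Sum>i\<in>UNIV. of_real (l i) * (v $ i * cnj (v $ i)))"
    by (simp add: cinner_def diag_mat_def matrix_vector_mult_def mult_delta_left mult_delta_right ac_simps)
  then show ?thesis by (simp add: complex_norm_square del: of_real_power)
qed

section \<open>Positive semidefinite matrices and their square roots\<close>

lemma psd_diag_mat:
  assumes "\<And>i. l i \<ge> 0"
  shows "psd (diag_mat l)"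
  by (simp add: psd_iff_cinner cinner_diag_mat assms sum_nonneg del: of_real_sum)

lemma psd_congruence:
  assumes "psd A"
  shows "psd (conj_transpose B ** A ** B)"
  using assms by (simp add: psd_iff_cinner matrix_vector_mul_assoc[symmetric] cinner_adjoint[of _ "conj_transpose B"])

lemma psd_add: "psd A \<Longrightarrow> psd B \<Longrightarrow> psd (A + B)"
  by (simp add: psd_iff_cinner matrix_vector_mult_add_rdistrib cinner_simps nonneg_Reals_add_I)

lemma psd_gram: "psd (conj_transpose B ** B)"
  unfolding psd_iff_cinner norm_sq_matrix_vector[symmetric] by simp

lemma psd_spectral:
  fixes A :: "'n::finite cmat"
  assumes "psd A"
  obtains U l where "conj_transpose U ** U = mat 1" "U ** conj_transpose U = mat 1"
    "A = U ** diag_mat l ** conj_transpose U" "\<And>i. l i \<ge> 0"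
proof -
  obtain U l where U: "conj_transpose U ** U = mat 1" "U ** conj_transpose U = mat 1"
    "A = U ** diag_mat l ** conj_transpose U"
    using hermitian_spectral[OF psd_imp_hermitian[OF assms]] by blast
  have "psd (conj_transpose U ** A ** U)" by (rule psd_congruence[OF assms])
  also have "conj_transpose U ** A ** U = diag_mat l"
    by (simp add: U(1,3) matrix_inverse_cancel_left[OF U(1)] flip: matrix_mul_assoc)
  finally have "psd (diag_mat l)" .
  have "l i \<ge> 0" for i
  proof -
    have "complex_of_real (l i) = cinner (axis i 1) (diag_mat l *v axis i 1)"
      by (simp flip: matrix_entry_cinner) (simp add: diag_mat_def)
    also have "\<dots> \<in> \<real>\<^sub>\<ge>\<^sub>0"
      using \<open>psd (diag_mat l)\<close> by (simp add: psd_iff_cinner)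
    finally show ?thesis by simp
  qed
  from U this show ?thesis by (rule that)
qed

lemma psd_unitary_diag:
  assumes "\<And>i. l i \<ge> 0"
  shows "psd (U ** diag_mat l ** conj_transpose U)"
  using psd_congruence[OF psd_diag_mat[of l], of "conj_transpose U"] assms by simp

lemma unitary_diag_mult:
  assumes "conj_transpose U ** U = mat 1"
  shows "(U ** diag_mat l ** conj_transpose U) ** (U ** diag_mat m ** conj_transpose U)
    = U ** diag_mat (\<lambda>i. l i * m i) ** conj_transpose U"
  by (simp add: matrix_inverse_cancel_left[OF assms] diag_mat_mult_left flip: matrix_mul_assoc)

lemma psd_ex_sqrt:
  assumes "psd A"
  shows "\<exists>P. psd P \<and> P ** P = A"
proof -
  obtain U l where U: "conj_transpose U ** U = mat 1" "U ** conj_transpose U = mat 1"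
    "A = U ** diag_mat l ** conj_transpose U" and l: "\<And>i. l i \<ge> 0"
    by (rule psd_spectral[OF assms]) (rule that)
  let ?P = "U ** diag_mat (\<lambda>i. sqrt (l i)) ** conj_transpose U"
  have "psd ?P" using l by (intro psd_unitary_diag) simp
  moreover have "?P ** ?P = A" using l by (simp add: unitary_diag_mult[OF U(1)] U(3))
  ultimately show ?thesis by blast
qed

text \<open>It suffices to compare \<open>P\<close> and \<open>Q\<close> on an eigenbasis of
  \<open>P\<close>. If P e = l e, then (Q + l)(Q - l) e = 0, so w = (Q - l) e satisfies Q w = - l w,
  and positivity of \<open>Q\<close> forces w = 0.\<close>

lemma psd_sqrt_unique:
  fixes P Q :: "'n::finite cmat"
  assumes P: "psd P" and Q: "psd Q" and eq: "P ** P = Q ** Q"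
  shows "P = Q"
proof -
  obtain U l where U: "conj_transpose U ** U = mat 1" "U ** conj_transpose U = mat 1"
    "P = U ** diag_mat l ** conj_transpose U" and l: "\<And>i. l i \<ge> 0"
    by (rule psd_spectral[OF P]) (rule that)
  define e where "e i = U *v axis i 1" for i
  have Pe: "P *v e i = of_real (l i) *s e i" for i
  proof -
    have "diag_mat l *v axis i 1 = of_real (l i) *s axis i 1"
      by (simp add: vec_eq_iff diag_mat_def matrix_vector_mult_def axis_def mult_delta_left)
    moreover have "P *v e i = U *v (diag_mat l *v axis i 1)"
      by (simp add: e_def U(1,3) matrix_vector_mul_assoc flip: matrix_mul_assoc)
    ultimately show ?thesis by (simp add: e_def vector_scalar_commute)
  qed
  have "Q *v e i = P *v e i" for i
  proof -
    define w where "w = Q *v e i - of_real (l i) *s e i"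
    have "Q *v (Q *v e i) = of_real (l i) *s (of_real (l i) *s e i)"
      by (metis Pe eq matrix_vector_mul_assoc vector_scalar_commute)
    then have Qw: "Q *v w = - of_real (l i) *s w"
      by (simp add: w_def matrix_vector_mult_diff_distrib vector_scalar_commute vec_eq_iff
          algebra_simps)
    have "w = 0"
    proof (cases "l i = 0")
      \<comment> \<open>For l = 0 the sign argument says nothing. Instead w = Q e and Q w = 0, so
        |w|^2 = <e, Q w> = 0.\<close>
      case True
      then have "cinner w w = cinner (Q *v e i) w" by (simp add: w_def)
      also have "\<dots> = cinner (e i) (Q *v w)"
        by (simp add: cinner_adjoint psd_imp_hermitian[OF Q])
      also have "\<dots> = 0" using Qw True by (simp add: cinner_simps)
      finally show ?thesis by simp
    next
      case False
      then have "l i > 0" using l[of i] by simp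
      have "cinner w (Q *v w) = of_real (- (l i * (norm w)\<^sup>2))"
        by (simp only: Qw cinner_simps cinner_self) simp
      moreover have "cinner w (Q *v w) \<in> \<real>\<^sub>\<ge>\<^sub>0" using Q by (simp add: psd_iff_cinner)
      ultimately have "- (l i * (norm w)\<^sup>2) \<ge> 0"
        by (simp only: nonneg_Reals_of_real_iff)
      then have "(norm w)\<^sup>2 \<le> 0"
        using \<open>l i > 0\<close> by (simp add: mult_le_0_iff)
      then show ?thesis by simp
    qed
    then show ?thesis by (simp add: w_def Pe)
  qed
  then have "(Q ** U) *v axis i 1 = (P ** U) *v axis i 1" for i
    by (simp add: e_def matrix_vector_mul_assoc)
  then have "(P ** U) $ j $ i = (Q ** U) $ j $ i" for i j
    by (simp add: matrix_entry_cinner)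
  then have "P ** U = Q ** U" by (simp add: vec_eq_iff)
  then have "P ** U ** conj_transpose U = Q ** U ** conj_transpose U" by simp
  then show ?thesis by (simp add: U(2) flip: matrix_mul_assoc)
qed

section \<open>Duality for the trace norm\<close>

text \<open>Uniqueness of the positive square root evaluates the definite description.\<close>

lemma mat_abs_eqI:
  assumes "psd P" "P ** P = conj_transpose X ** X"
  shows "mat_abs X = P"
  unfolding mat_abs_def
proof (rule the_equality)
  show "Q = P" if "psd Q \<and> Q ** Q = conj_transpose X ** X" for Q
    using that assms psd_sqrt_unique[of Q P] by simp
qed (use assms in simp)

lemma mat_abs:
  "psd (mat_abs X)" "mat_abs X ** mat_abs X = conj_transpose X ** X"
proof -
  obtain P where P: "psd P" "P ** P = conj_transpose X ** X"
    using psd_ex_sqrt[OF psd_gram] by blast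
  moreover have "mat_abs X = P" using P by (rule mat_abs_eqI)
  ultimately show "psd (mat_abs X)" "mat_abs X ** mat_abs X = conj_transpose X ** X"
    by simp_all
qed

text \<open>Operator norm at most 1, written as a bound on the sesquilinear form because the Gram
  factorisation of a Schur product decomposes exactly this form.\<close>

definition sesqui_contraction :: "'n::finite cmat \<Rightarrow> bool" where
  "sesqui_contraction W \<longleftrightarrow> (\<forall>x y. cmod (cinner x (W *v y)) \<le> norm x * norm y)"

lemma norm_unitary:
  assumes "conj_transpose U ** U = mat 1"
  shows "norm (U *v x) = norm x"
proof -
  have "complex_of_real ((norm (U *v x))\<^sup>2) = of_real ((norm x)\<^sup>2)"
    unfolding norm_sq_matrix_vector assms by (simp add: cinner_self)
  then have "(norm (U *v x))\<^sup>2 = (norm x)\<^sup>2" by (simp only: of_real_eq_iff)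
  then show ?thesis by (simp add: power2_eq_iff_nonneg)
qed

text \<open>The trace is computed in an eigenbasis of \<open>mat_abs X\<close>. Since
  \<open>X\<close> and \<open>mat_abs X\<close> stretch every vector equally, the i-th diagonal term
  is at most the eigenvalue \<open>l i\<close>, and these sum to the trace norm.\<close>

lemma trace_contraction_le:
  assumes W: "sesqui_contraction W"
  shows "cmod (trace (W ** X)) \<le> trace_norm X"
proof -
  obtain U l where U: "conj_transpose U ** U = mat 1" "U ** conj_transpose U = mat 1"
    "mat_abs X = U ** diag_mat l ** conj_transpose U" and l: "\<And>i. l i \<ge> 0"
    by (rule psd_spectral[OF mat_abs(1)]) (rule that)
  have tr: "trace_norm X = (\<Sum>i\<in>UNIV. l i)"
    by (simp add: trace_norm_def U(3) trace_mul_sym[of _ "conj_transpose U"] matrix_mul_assoc U(1)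
        trace_diag_mat)
  have "trace (W ** X) = trace (conj_transpose U ** (W ** X) ** U)"
    by (simp add: trace_mul_sym[of _ U] matrix_mul_assoc U(2))
  also have "\<dots> = (\<Sum>i\<in>UNIV. cinner (U *v axis i 1) (W *v (X *v (U *v axis i 1))))"
    by (simp add: trace_def matrix_entry_cinner matrix_vector_mul_assoc[symmetric]
        cinner_adjoint[of _ "conj_transpose U"])
  also have "cmod \<dots> \<le> (\<Sum>i\<in>UNIV. l i)"
  proof (rule order_trans[OF norm_sum sum_mono])
    fix i
    let ?e = "U *v axis i (1::complex)"
    have "cmod (cinner ?e (W *v (X *v ?e))) \<le> norm ?e * norm (X *v ?e)"
      using W by (simp add: sesqui_contraction_def)
    also have "norm ?e = 1" by (simp add: norm_unitary[OF U(1)] norm_eq_sqrt_inner[of "axis i 1"] inner_axis_axis)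
    also have "norm (X *v ?e) = l i"
    proof -
      have "complex_of_real ((norm (X *v ?e))\<^sup>2) = cinner (axis i 1)
          ((conj_transpose U ** (mat_abs X ** mat_abs X) ** U) *v axis i 1)"
        by (simp only: norm_sq_matrix_vector mat_abs cinner_adjoint[of _ "conj_transpose U"]
            matrix_vector_mul_assoc[symmetric] conj_transpose_conj_transpose)
      also have "conj_transpose U ** (mat_abs X ** mat_abs X) ** U = diag_mat (\<lambda>i. l i * l i)"
        unfolding U(3) unitary_diag_mult[OF U(1)]
        by (simp add: U(1) matrix_inverse_cancel_left[OF U(1)] flip: matrix_mul_assoc)
      also have "cinner (axis i 1) (\<dots> *v axis i 1) = of_real ((l i)\<^sup>2)"
        by (simp flip: matrix_entry_cinner) (simp add: diag_mat_def power2_eq_square)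
      finally have "(norm (X *v ?e))\<^sup>2 = (l i)\<^sup>2" by (simp only: of_real_eq_iff)
      then show ?thesis using l by (simp add: power2_eq_iff_nonneg)
    qed
    finally show "cmod (cinner ?e (W *v (X *v ?e))) \<le> l i" by simp
  qed
  finally show ?thesis by (simp add: tr)
qed

text \<open>The bound of the duality is attained by the adjoint of the partial isometry in the polar
  decomposition of \<open>Y\<close>; it satisfies \<open>W ** Y = mat_abs Y\<close>.\<close>

lemma ex_contraction_trace_norm:
  fixes Y :: "'n::finite cmat"
  shows "\<exists>W. sesqui_contraction W \<and> trace (W ** Y) = of_real (trace_norm Y)"
proof -
  obtain U l where U: "conj_transpose U ** U = mat 1" "U ** conj_transpose U = mat 1"
    "mat_abs Y = U ** diag_mat l ** conj_transpose U" and l: "\<And>i. l i \<ge> 0"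
    by (rule psd_spectral[OF mat_abs(1)]) (rule that)
  \<comment> \<open>As 1 / 0 = 0, this is the Moore-Penrose inverse of \<open>mat_abs Y\<close>,
    also when \<open>Y\<close> is singular.\<close>
  define G where "G = U ** diag_mat (\<lambda>i. 1 / l i) ** conj_transpose U"
  have G: "conj_transpose G = G"
    by (simp add: G_def conj_transpose_mult matrix_mul_assoc)
  define W where "W = G ** conj_transpose Y"
  have YY: "conj_transpose Y ** Y = U ** diag_mat (\<lambda>i. l i * l i) ** conj_transpose U"
    by (simp add: mat_abs(2)[symmetric] U(3) unitary_diag_mult[OF U(1)])
  have "W ** Y = U ** diag_mat (\<lambda>i. 1 / l i * (l i * l i)) ** conj_transpose U"
    unfolding W_def matrix_mul_assoc[symmetric] YY unfolding G_def
    by (simp add: matrix_inverse_cancel_left[OF U(1)] diag_mat_mult_left flip: matrix_mul_assoc)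
  also have "(\<lambda>i. 1 / l i * (l i * l i)) = l" by (simp add: fun_eq_iff)
  finally have "trace (W ** Y) = trace (mat_abs Y)" by (simp add: U(3))
  also have "\<dots> = of_real (trace_norm Y)"
    by (simp add: trace_norm_def U(3) trace_mul_sym[of _ "conj_transpose U"] matrix_mul_assoc U(1)
        trace_diag_mat del: of_real_sum)
  finally have tr: "trace (W ** Y) = of_real (trace_norm Y)" .
  have nW: "norm (conj_transpose W *v x) \<le> norm x" for x
  proof -
    \<comment> \<open>Each value is 1 or 0, according to whether \<open>l i\<close> is nonzero:
      \<open>W ** conj_transpose W\<close> is an orthogonal projection.\<close>
    let ?p = "\<lambda>i. 1 / l i * (l i * l i) * (1 / l i)"
    let ?z = "conj_transpose U *v x"
    have "W ** conj_transpose W = G ** (conj_transpose Y ** Y) ** G"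
      by (simp add: W_def conj_transpose_mult G matrix_mul_assoc)
    also have "\<dots> = U ** diag_mat ?p ** conj_transpose U"
      by (simp only: YY G_def unitary_diag_mult[OF U(1)])
    finally have "complex_of_real ((norm (conj_transpose W *v x))\<^sup>2)
        = cinner ?z (diag_mat ?p *v ?z)"
      by (simp only: norm_sq_matrix_vector conj_transpose_conj_transpose
          matrix_vector_mul_assoc[symmetric] cinner_adjoint[of x U])
    also have "\<dots> = of_real (\<Sum>i\<in>UNIV. ?p i * (cmod (?z $ i))\<^sup>2)"
      by (rule cinner_diag_mat)
    finally have "(norm (conj_transpose W *v x))\<^sup>2 = (\<Sum>i\<in>UNIV. ?p i * (cmod (?z $ i))\<^sup>2)"
      by (simp only: of_real_eq_iff)
    also have "\<dots> \<le> (\<Sum>i\<in>UNIV. (cmod (?z $ i))\<^sup>2)"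
      by (intro sum_mono) auto
    also have "\<dots> = (norm x)\<^sup>2"
      using norm_unitary[of "conj_transpose U" x] U(2) by (simp flip: norm_sq_vec)
    finally show ?thesis by (simp add: power2_le_iff_abs_le)
  qed
  have "sesqui_contraction W"
    unfolding sesqui_contraction_def cinner_adjoint
    using cinner_Cauchy_Schwarz nW by (meson mult_right_mono norm_ge_zero order_trans)
  with tr show ?thesis by blast
qed

section \<open>Schur multipliers\<close>

definition hadamard :: "'n::finite cmat \<Rightarrow> 'n cmat \<Rightarrow> 'n cmat" where
  "hadamard S X = (\<chi> k j. S $ k $ j * X $ k $ j)"

lemma schur_multiplier_hadamard: "blinfun_apply (schur_multiplier S) X = hadamard S X"
  by (simp add: schur_multiplier_apply hadamard_def)

text \<open>The positive square root serves as \<open>R\<close>; its columns are vectors whose inner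
  products are the entries of \<open>S\<close>.\<close>

lemma psd_ex_gram:
  assumes "psd S"
  shows "\<exists>R. S = conj_transpose R ** R"
  using psd_ex_sqrt[OF assms] psd_imp_hermitian by metis

text \<open>This is D_m x, where D_m is the diagonal matrix formed from row m of \<open>R\<close>.
  The D_m are Kraus operators of the Schur multiplier with matrix
  \<open>conj_transpose R ** R\<close>.\<close>

definition weight_row :: "'n::finite cmat \<Rightarrow> 'n \<Rightarrow> complex^'n \<Rightarrow> complex^'n" where
  "weight_row R m x = (\<chi> k. R $ m $ k * x $ k)"

lemma cinner_hadamard_gram:
  "cinner x (hadamard (conj_transpose R ** R) W *v y)
    = (\<Sum>m\<in>UNIV. cinner (weight_row R m x) (W *v weight_row R m y))"
proof -
  let ?t = "\<lambda>k j m. cnj (x $ k) * (cnj (R $ m $ k) * R $ m $ j * W $ k $ j * y $ j)"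
  have "cinner x (hadamard (conj_transpose R ** R) W *v y)
      = (\<Sum>k\<in>UNIV. \<Sum>j\<in>UNIV. \<Sum>m\<in>UNIV. ?t k j m)"
    by (simp add: cinner_def hadamard_def matrix_vector_mult_def matrix_matrix_mult_def
        conj_transpose_def sum_distrib_left sum_distrib_right)
  also have "\<dots> = (\<Sum>k\<in>UNIV. \<Sum>m\<in>UNIV. \<Sum>j\<in>UNIV. ?t k j m)"
    by (intro sum.cong refl sum.swap)
  also have "\<dots> = (\<Sum>m\<in>UNIV. \<Sum>k\<in>UNIV. \<Sum>j\<in>UNIV. ?t k j m)"
    by (rule sum.swap)
  also have "\<dots> = (\<Sum>m\<in>UNIV. cinner (weight_row R m x) (W *v weight_row R m y))"
    by (simp add: cinner_def weight_row_def matrix_vector_mult_def sum_distrib_left ac_simps)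
  finally show ?thesis .
qed

lemma sum_in_nonneg_Reals:
  fixes f :: "'a \<Rightarrow> complex"
  shows "(\<And>x. x \<in> A \<Longrightarrow> f x \<in> \<real>\<^sub>\<ge>\<^sub>0) \<Longrightarrow> sum f A \<in> \<real>\<^sub>\<ge>\<^sub>0"
  by (induction A rule: infinite_finite_induct) (auto intro: nonneg_Reals_add_I)

text \<open>Schur product theorem: by the Gram factorisation of \<open>S\<close>, the form of the
  product is a sum of values of the form of \<open>X\<close>.\<close>

lemma psd_hadamard:
  assumes "psd S" "psd X"
  shows "psd (hadamard S X)"
proof -
  obtain R where "S = conj_transpose R ** R" using psd_ex_gram[OF assms(1)] by blast
  then show ?thesis
    using assms(2) unfolding psd_iff_cinner cinner_hadamard_gram
    by (auto simp: psd_iff_cinner cinner_hadamard_gram intro!: sum_in_nonneg_Reals)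
qed

text \<open>The unit diagonal says that the columns of \<open>R\<close> are unit vectors, so summing
  the squared weights over m leaves each coordinate of \<open>x\<close> with weight 1.\<close>

lemma norm_weight_rows:
  assumes "\<And>k. (conj_transpose R ** R) $ k $ k = 1"
  shows "L2_set (\<lambda>m. norm (weight_row R m x)) UNIV = norm x"
proof -
  have R: "(\<Sum>m\<in>UNIV. (cmod (R $ m $ k))\<^sup>2) = 1" for k
  proof -
    have "complex_of_real (\<Sum>m\<in>UNIV. (cmod (R $ m $ k))\<^sup>2) = (conj_transpose R ** R) $ k $ k"
      by (simp only: of_real_sum complex_norm_square)
        (simp add: matrix_matrix_mult_def conj_transpose_def mult.commute)
    then show ?thesis using assms[of k] by (simp only: of_real_eq_1_iff)
  qed
  have "(\<Sum>m\<in>UNIV. (norm (weight_row R m x))\<^sup>2)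
      = (\<Sum>m\<in>UNIV. \<Sum>k\<in>UNIV. (cmod (R $ m $ k))\<^sup>2 * (cmod (x $ k))\<^sup>2)"
    by (simp add: norm_sq_vec weight_row_def norm_mult power_mult_distrib)
  also have "\<dots> = (\<Sum>k\<in>UNIV. \<Sum>m\<in>UNIV. (cmod (R $ m $ k))\<^sup>2 * (cmod (x $ k))\<^sup>2)"
    by (rule sum.swap)
  also have "\<dots> = (norm x)\<^sup>2"
    by (simp add: norm_sq_vec R flip: sum_distrib_right)
  finally show ?thesis by (simp add: L2_set_def)
qed

text \<open>Contractivity of \<open>W\<close> bounds each Gram summand; Cauchy-Schwarz over m then
  recombines the weighted norms into those of \<open>x\<close> and \<open>y\<close>.\<close>

lemma sesqui_contraction_hadamard:
  assumes S: "psd S" "\<And>k. S $ k $ k = 1" and W: "sesqui_contraction W"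
  shows "sesqui_contraction (hadamard S W)"
proof -
  obtain R where R: "S = conj_transpose R ** R" using psd_ex_gram[OF S(1)] by blast
  have "cmod (cinner x (hadamard S W *v y)) \<le> norm x * norm y" for x y
  proof -
    have "cmod (cinner x (hadamard S W *v y))
        \<le> (\<Sum>m\<in>UNIV. \<bar>norm (weight_row R m x)\<bar> * \<bar>norm (weight_row R m y)\<bar>)"
      unfolding R cinner_hadamard_gram using W
      by (intro order_trans[OF norm_sum sum_mono]) (simp add: sesqui_contraction_def)
    also have "\<dots> \<le> norm x * norm y"
      using L2_set_mult_ineq[of "\<lambda>m. norm (weight_row R m x)" "\<lambda>m. norm (weight_row R m y)" UNIV]
      by (simp only: norm_weight_rows[OF S(2)[unfolded R]])
    finally show ?thesis .
  qed
  then show ?thesis by (simp add: sesqui_contraction_def)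
qed

text \<open>The form of the transpose at v is the form of \<open>S\<close> at the entrywise
  conjugate of v.\<close>

lemma psd_transpose:
  assumes "psd S"
  shows "psd (transpose S)"
proof -
  have "cinner v (transpose S *v v) = cinner (\<chi> k. cnj (v $ k)) (S *v (\<chi> k. cnj (v $ k)))" for v
    unfolding cinner_def matrix_vector_mult_def transpose_def
    by (simp add: sum_distrib_left ac_simps) (rule sum.swap)
  then show ?thesis using assms by (simp add: psd_iff_cinner)
qed

text \<open>Under the bilinear pairing trace(W X), the dual of Schur multiplication by
  \<open>S\<close> is Schur multiplication by its transpose.\<close>

lemma trace_mult_hadamard:
  "trace (W ** hadamard S X) = trace (hadamard (transpose S) W ** X)"
  by (simp add: trace_def matrix_matrix_mult_def hadamard_def transpose_def ac_simps)

lemma trace_norm_hadamard_le: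
  assumes "psd S" "\<And>k. S $ k $ k = 1"
  shows "trace_norm (hadamard S X) \<le> trace_norm X"
proof -
  obtain W where W: "sesqui_contraction W"
    "trace (W ** hadamard S X) = of_real (trace_norm (hadamard S X))"
    using ex_contraction_trace_norm by blast
  have "sesqui_contraction (hadamard (transpose S) W)"
    using assms W(1) by (intro sesqui_contraction_hadamard psd_transpose) (simp_all add: transpose_def)
  from trace_contraction_le[OF this, of X] show ?thesis
    by (simp add: W(2) flip: trace_mult_hadamard)
qed

lemma schur_channels_subset: "schur_channels \<subseteq> pos_schur_contractions"
proof
  fix \<Phi> :: "'a::finite superop"
  assume "\<Phi> \<in> schur_channels"
  then obtain S where S: "\<Phi> = schur_multiplier S" "psd S" "\<And>k. S $ k $ k = 1"
    by (auto simp: schur_channels_def)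
  have "superop_norm1 \<Phi> \<le> 1"
    unfolding superop_norm1_def S(1) schur_multiplier_hadamard
    using trace_norm_hadamard_le[OF S(2,3)]
    by (intro SUP_least) (auto simp: one_ereal_def intro: order_trans)
  moreover have "positive_superop \<Phi>"
    unfolding positive_superop_def S(1) schur_multiplier_hadamard
    using psd_hadamard[OF S(2)] by blast
  ultimately show "\<Phi> \<in> pos_schur_contractions"
    using S(1) by (auto simp: pos_schur_contractions_def schur_contractions_def)
qed

section \<open>Matrices of positive contractions and their normalisation to unit diagonal\<close>

lemma trace_norm_psd: "psd P \<Longrightarrow> trace_norm P = Re (trace P)"
  by (simp add: trace_norm_def mat_abs_eqI psd_imp_hermitian)

lemma pos_schur_contractionE:
  fixes \<Phi> :: "'n::finite superop"
  assumes "\<Phi> \<in> pos_schur_contractions"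
  obtains S where "\<Phi> = schur_multiplier S" "psd S" "\<And>k. Re (S $ k $ k) \<le> 1"
proof -
  obtain S where S: "\<Phi> = schur_multiplier S" and norm: "superop_norm1 \<Phi> \<le> 1"
    and pos: "\<And>X. psd X \<Longrightarrow> psd (hadamard S X)"
    using assms
    by (auto simp: pos_schur_contractions_def schur_contractions_def positive_superop_def
        schur_multiplier_hadamard)
  \<comment> \<open>The all-ones matrix is the identity for the Schur product, so positivity of the
    map at this matrix is positivity of \<open>S\<close>.\<close>
  have "psd ((\<chi> k j. 1) :: 'n cmat)"
  proof -
    have "cinner v ((\<chi> k j. 1) *v v) = of_real ((cmod (\<Sum>k\<in>UNIV. v $ k))\<^sup>2)" for v :: "complex^'n"
      by (simp only: complex_norm_square cinner_def matrix_vector_mult_def)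
        (simp add: mult.commute flip: sum_distrib_right sum_distrib_left)
    then show ?thesis by (simp add: psd_iff_cinner del: of_real_power)
  qed
  from pos[OF this] have "psd S" by (simp add: hadamard_def)
  moreover have "Re (S $ k $ k) \<le> 1" for k
  proof -
    \<comment> \<open>A diagonal matrix unit has trace norm 1, and its image is the same unit scaled
      by the k-th diagonal entry of \<open>S\<close>.\<close>
    let ?E = "diag_mat (\<lambda>i. if i = k then 1 else 0)"
    have E: "psd ?E" by (rule psd_diag_mat) simp
    have "trace_norm ?E = 1" by (simp add: trace_norm_psd[OF E] trace_diag_mat)
    then have "ereal (trace_norm (hadamard S ?E)) \<le> superop_norm1 \<Phi>"
      unfolding superop_norm1_def S schur_multiplier_hadamard by (intro SUP_upper) simp
    also have "trace_norm (hadamard S ?E) = Re (S $ k $ k)"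
    proof -
      have "trace (hadamard S ?E) = (\<Sum>i\<in>UNIV. if i = k then S $ i $ i else 0)"
        unfolding trace_def hadamard_def diag_mat_def by (intro sum.cong) simp_all
      then show ?thesis by (simp add: trace_norm_psd[OF pos[OF E]])
    qed
    finally have "ereal (Re (S $ k $ k)) \<le> 1" using norm by (rule order_trans)
    then show ?thesis by (simp add: one_ereal_def)
  qed
  ultimately show thesis using S that by blast
qed

text \<open>In a Gram factorisation the diagonal entry is the squared norm of column k of
  \<open>R\<close>; if it is 0, that column is 0 and so are all its inner products.\<close>

lemma psd_diag_eq_0:
  assumes "psd S" "S $ k $ k = 0"
  shows "S $ j $ k = 0" "S $ k $ j = 0"
proof -
  obtain R where R: "S = conj_transpose R ** R" using psd_ex_gram[OF assms(1)] by blast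
  have "complex_of_real ((norm (R *v axis k 1))\<^sup>2) = S $ k $ k"
    by (simp only: norm_sq_matrix_vector R matrix_entry_cinner)
  then have "R *v axis k 1 = 0" using assms(2) by simp
  then show *: "S $ j $ k = 0"
    by (simp add: matrix_entry_cinner R cinner_simps flip: matrix_vector_mul_assoc)
  have "S $ k $ j = cnj (S $ j $ k)"
    using psd_imp_hermitian[OF assms(1)] by (simp add: conj_transpose_def vec_eq_iff)
  with * show "S $ k $ j = 0" by simp
qed

lemma psd_diag_real:
  assumes "psd S"
  shows "S $ k $ k = of_real (Re (S $ k $ k))" "Re (S $ k $ k) \<ge> 0"
proof -
  have "S $ k $ k \<in> \<real>\<^sub>\<ge>\<^sub>0" using assms by (simp add: matrix_entry_cinner psd_iff_cinner)
  then show "S $ k $ k = of_real (Re (S $ k $ k))" "Re (S $ k $ k) \<ge> 0"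
    by (auto simp: complex_nonneg_Reals_iff complex_eq_iff)
qed

lemma diag_mat_conj_entry:
  "(diag_mat a ** S ** diag_mat b) $ k $ j = of_real (a k) * S $ k $ j * of_real (b j)"
  by (simp add: diag_mat_def matrix_matrix_mult_def mult_delta_left mult_delta_right)

text \<open>Zero diagonal entries of \<open>S\<close> are replaced by ones in \<open>T\<close>; the corresponding rows and
  columns of \<open>S\<close> vanish.\<close>

lemma psd_factor_correlation:
  assumes "psd S" "\<And>k. Re (S $ k $ k) \<le> 1"
  obtains T d where "psd T" "\<And>k. T $ k $ k = 1" "\<And>k. 0 \<le> d k" "\<And>k. d k \<le> 1"
    "S = hadamard (\<chi> k j. of_real (d k * d j)) T"
proof -
  define d where "d k = sqrt (Re (S $ k $ k))" for k
  \<comment> \<open>With 1 / 0 = 0 the first summand vanishes in the rows and columns where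
    \<open>d k = 0\<close>; the second restores the diagonal entry 1 there.\<close>
  define T where "T = diag_mat (\<lambda>k. 1 / d k) ** S ** diag_mat (\<lambda>k. 1 / d k)
    + diag_mat (\<lambda>k. if d k = 0 then 1 else 0)"
  have Skk: "S $ k $ k = of_real (d k * d k)" for k
    using psd_diag_real[OF assms(1), of k] by (simp add: d_def flip: of_real_mult)
  have T: "T $ k $ j = S $ k $ j / of_real (d k * d j)
      + (if k = j \<and> d k = 0 then 1 else 0)" for k j
    by (simp add: T_def diag_mat_conj_entry) (simp add: diag_mat_def)
  show thesis
  proof (rule that[of T d])
    show "psd T" unfolding T_def
      using psd_congruence[OF assms(1), of "diag_mat (\<lambda>k. 1 / d k)"]
      by (intro psd_add psd_diag_mat) simp_all
    show "T $ k $ k = 1" for k by (simp add: T Skk)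
    show "0 \<le> d k" "d k \<le> 1" for k
      using psd_diag_real(2)[OF assms(1), of k] assms(2)[of k] by (simp_all add: d_def)
    have "S $ k $ j = of_real (d k * d j) * T $ k $ j" for k j
    proof (cases "d k = 0 \<or> d j = 0")
      case True
      then have "S $ k $ j = 0" using psd_diag_eq_0[OF assms(1)] Skk by auto
      with True show ?thesis by auto
    qed (simp add: T)
    then show "S = hadamard (\<chi> k j. of_real (d k * d j)) T"
      by (simp add: hadamard_def vec_eq_iff)
  qed
qed

section \<open>Scaling of the convex hull and equivalence of the two inclusions\<close>

lemma schur_multiplier_compose:
  "schur_multiplier (hadamard S T) = schur_multiplier S o\<^sub>L schur_multiplier T"
  by (rule blinfun_eqI) (simp add: schur_multiplier_hadamard hadamard_def mult.assoc)

text \<open>The factors are absorbed into the coefficients: \<alpha>_k becomes d_k \<alpha>_k, still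
  of modulus at most 1.\<close>

lemma scaled_pos_diag_contraction:
  assumes "\<And>k. \<bar>d k\<bar> \<le> 1" and "\<Phi> \<in> pos_diag_contractions"
  shows "schur_multiplier (\<chi> k j. of_real (d k * d j)) o\<^sub>L \<Phi> \<in> pos_diag_contractions"
proof -
  obtain \<alpha> where \<alpha>: "\<Phi> = schur_multiplier (\<chi> k j. cnj (\<alpha> $ k) * \<alpha> $ j)"
    "\<And>k. cmod (\<alpha> $ k) \<le> 1"
    using assms(2) by (auto simp: pos_diag_contractions_def)
  define \<beta> where "\<beta> = (\<chi> k. of_real (d k) * \<alpha> $ k)"
  have "schur_multiplier (\<chi> k j. of_real (d k * d j)) o\<^sub>L \<Phi>
      = schur_multiplier (\<chi> k j. cnj (\<beta> $ k) * \<beta> $ j)"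
    unfolding \<alpha>(1) schur_multiplier_compose[symmetric]
    by (rule arg_cong[of _ _ schur_multiplier])
      (simp add: hadamard_def \<beta>_def vec_eq_iff ac_simps)
  moreover have "cmod (\<beta> $ k) \<le> 1" for k
    using assms(1)[of k] \<alpha>(2)[of k] by (simp add: \<beta>_def norm_mult mult_le_one)
  ultimately show ?thesis by (auto simp: pos_diag_contractions_def)
qed

text \<open>Composition with a fixed map is linear, so it carries the hull into the hull of the
  image of the generators.\<close>

lemma scaled_convex_hull_pos_diag_contractions:
  fixes \<Phi> :: "'n::finite superop"
  assumes "\<And>k. \<bar>d k\<bar> \<le> 1" and "\<Phi> \<in> convex hull pos_diag_contractions"
  shows "schur_multiplier (\<chi> k j. of_real (d k * d j)) o\<^sub>L \<Phi> \<in> convex hull pos_diag_contractions"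
proof -
  let ?f = "\<lambda>\<Phi>::'n superop. schur_multiplier (\<chi> k j. of_real (d k * d j)) o\<^sub>L \<Phi>"
  have "linear ?f"
    by (intro bounded_linear.linear bounded_bilinear.bounded_linear_right
        bounded_bilinear_blinfun_compose)
  then have "?f \<Phi> \<in> convex hull (?f ` pos_diag_contractions)"
    using assms(2) by (rule in_convex_hull_linear_image)
  also have "\<dots> \<subseteq> convex hull pos_diag_contractions"
    using scaled_pos_diag_contraction[OF assms(1)] by (intro hull_mono) auto
  finally show ?thesis .
qed

text \<open>Holding for every real \<open>K\<close>, the equivalence makes the two predicates under
  \<open>LEAST\<close> identical, and hence the two constants equal.\<close>

lemma schur_channels_subset_iff:
  "(schur_channels :: 'n::finite superop set) \<subseteq> (\<lambda>\<Phi>. K *\<^sub>R \<Phi>) ` (convex hull pos_diag_contractions) \<longleftrightarrow>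
   (pos_schur_contractions :: 'n superop set) \<subseteq> (\<lambda>\<Phi>. K *\<^sub>R \<Phi>) ` (convex hull pos_diag_contractions)"
  (is "?lhs \<longleftrightarrow> ?rhs")
proof
  assume L: ?lhs
  show ?rhs
  proof
    fix \<Phi> :: "'n superop"
    assume "\<Phi> \<in> pos_schur_contractions"
    then obtain S where S: "\<Phi> = schur_multiplier S" "psd S" "\<And>k. Re (S $ k $ k) \<le> 1"
      by (rule pos_schur_contractionE) (rule that)
    obtain T d where T: "psd T" "\<And>k. T $ k $ k = 1" and d: "\<And>k. 0 \<le> d k" "\<And>k. d k \<le> 1"
      and ST: "S = hadamard (\<chi> k j. of_real (d k * d j)) T"
      by (rule psd_factor_correlation[OF S(2,3)]) (rule that)
    have "schur_multiplier T \<in> schur_channels"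
      using T by (auto simp: schur_channels_def)
    with L obtain \<Psi> where \<Psi>: "schur_multiplier T = K *\<^sub>R \<Psi>"
      "\<Psi> \<in> convex hull pos_diag_contractions" by blast
    \<comment> \<open>The diagonal scaling is composed with the decomposition of the channel of
      \<open>T\<close>; by linearity \<open>K\<close> passes through unchanged.\<close>
    have "\<Phi> = K *\<^sub>R (schur_multiplier (\<chi> k j. of_real (d k * d j)) o\<^sub>L \<Psi>)"
      unfolding S(1) ST schur_multiplier_compose \<Psi>(1)
      by (rule blinfun_eqI) (simp add: blinfun.scaleR_left blinfun.scaleR_right)
    moreover have "schur_multiplier (\<chi> k j. of_real (d k * d j)) o\<^sub>L \<Psi>
        \<in> convex hull pos_diag_contractions"
      using d \<Psi>(2) by (intro scaled_convex_hull_pos_diag_contractions) simp_all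
    ultimately show "\<Phi> \<in> (\<lambda>\<Phi>. K *\<^sub>R \<Phi>) ` (convex hull pos_diag_contractions)" by blast
  qed
qed (use schur_channels_subset in blast)

theorem proposition5:
  shows "K_plus_1 TYPE('n::finite) = K_plus TYPE('n)"
  unfolding K_plus_1_def K_plus_def by (simp only: schur_channels_subset_iff)

end
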